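(* Let $(A,\mu_0)$ be a skew-symmetric anti-associative algebra over $\mathbb{K}$, write $xy=\mu_0(x,y)$, and let $\mu_t=\mu_0+\sum_{k\ge 1}t^k\varphi_k$ be an anti-associative formal deformation of $\mu_0$. Let $\rho_1$ be the symmetric bilinear map attached to $\varphi_1$. Then $(A,\mu_0,\rho_1)$ is an anti-Poisson algebra, that is: (1) $(A,\rho_1)$ is a Jacobi-Jordan algebra; (2) the products $\mu_0$ and $\rho_1$ satisfy the graded Leibniz identity $$\rho_1(xy,z)+x\,\rho_1(y,z)+\rho_1(x,z)\,y=0\qquad\text{for all }x,y,z\in A .$$
   Context: $\mathbb{K}$ is a field of characteristic $0$; an algebra $(A,\mu)$ is a $\mathbb{K}$-vector space $A$ with a bilinear map $\mu:A\times A\to A$. $(A,\mu)$ is anti-associative if $\mu(\mu(x,y),z)+\mu(x,\mu(y,z))=0$ for all $x,y,z\in A$. It is skew-symmetric if $\mu(x,y)=-\mu(y,x)$. An anti-associative formal deformation of $\mu_0$ is a family of bilinear maps $\varphi_j:A\times A\to A$ ($j\ge 0$) with $\varphi_0=\mu_0$, written $\mu_t=\mu_0+\sum_{k\geq 1} t^k\varphi_k$, such that for all $k\ge 0$ and $x,y,z\in A$, $$\sum_{i+j=k}\big(\varphi_i(\varphi_j(x,y),z)+\varphi_i(x,\varphi_j(y,z))\big)=0 .$$ The symmetric map attached to $\varphi_1$ is $\rho_1(x,y)=\varphi_1(x,y)+\varphi_1(y,x)$. A Jacobi-Jordan algebra is an algebra $(A,\rho)$ with $\rho$ commutative and $\rho(x,\rho(y,z))+\rho(y,\rho(z,x))+\rho(z,\rho(x,y))=0$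 for all $x,y,z\in A$. *)

theory Defs
  imports Complex_Main
begin

text \<open>
  Products are curried maps on a type \<open>'a\<close>; the underlying vector space is given by the scalar
  action \<open>scale\<close> of a field \<open>'k\<close> of characteristic 0.  No finiteness of dimension is assumed.
  The name \<open>linear\<close> is qualified because its short form denotes real-linear maps.
\<close>

definition bilinear_product ::
    "('k::field_char_0 \<Rightarrow> 'a::ab_group_add \<Rightarrow> 'a) \<Rightarrow> ('a \<Rightarrow> 'a \<Rightarrow> 'a) \<Rightarrow> bool"
  where "bilinear_product scale \<mu> \<longleftrightarrow>
    (\<forall>x. Vector_Spaces.linear scale scale (\<lambda>y. \<mu> x y)) \<and>
    (\<forall>y. Vector_Spaces.linear scale scale (\<lambda>x. \<mu> x y))"

locale nonassoc_algebra = vector_space scale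
  for scale :: "'k::field_char_0 \<Rightarrow> 'a::ab_group_add \<Rightarrow> 'a" +
  fixes \<mu> :: "'a \<Rightarrow> 'a \<Rightarrow> 'a"
  assumes bilinear: "bilinear_product scale \<mu>"

locale anti_associative_algebra = nonassoc_algebra scale \<mu>
  for scale :: "'k::field_char_0 \<Rightarrow> 'a::ab_group_add \<Rightarrow> 'a" and \<mu> +
  assumes anti_assoc: "\<mu> (\<mu> x y) z + \<mu> x (\<mu> y z) = 0"

locale skew_anti_associative_algebra = anti_associative_algebra scale \<mu>
  for scale :: "'k::field_char_0 \<Rightarrow> 'a::ab_group_add \<Rightarrow> 'a" and \<mu> +
  assumes skew: "\<mu> x y = - \<mu> y x"

locale jacobi_jordan_algebra = nonassoc_algebra scale \<rho>
  for scale :: "'k::field_char_0 \<Rightarrow> 'a::ab_group_add \<Rightarrow> 'a" and \<rho> +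
  assumes commute: "\<rho> x y = \<rho> y x"
    and jacobi: "\<rho> x (\<rho> y z) + \<rho> y (\<rho> z x) + \<rho> z (\<rho> x y) = 0"

locale anti_poisson_algebra =
  skew_anti_associative_algebra scale \<mu> + jacobi_jordan_algebra scale \<rho>
  for scale :: "'k::field_char_0 \<Rightarrow> 'a::ab_group_add \<Rightarrow> 'a" and \<mu> and \<rho> +
  assumes graded_leibniz: "\<rho> (\<mu> x y) z + \<mu> x (\<rho> y z) + \<mu> (\<rho> x z) y = 0"

text \<open>
  The formal deformation \<open>\<mu>\<^sub>0 + \<Sum>k\<ge>1. t^k \<phi>\<^sub>k\<close> is represented by its sequence of coefficients
  \<open>\<phi>\<close>; the last clause is the vanishing of the coefficient of \<open>t^k\<close> in the anti-associator.
\<close>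

definition anti_associative_deformation ::
    "('k::field_char_0 \<Rightarrow> 'a::ab_group_add \<Rightarrow> 'a) \<Rightarrow> ('a \<Rightarrow> 'a \<Rightarrow> 'a) \<Rightarrow> (nat \<Rightarrow> 'a \<Rightarrow> 'a \<Rightarrow> 'a) \<Rightarrow> bool"
  where "anti_associative_deformation scale \<mu>\<^sub>0 \<phi> \<longleftrightarrow>
    \<phi> 0 = \<mu>\<^sub>0 \<and>
    (\<forall>j. bilinear_product scale (\<phi> j)) \<and>
    (\<forall>k x y z. (\<Sum>i\<le>k. \<phi> i (\<phi> (k - i) x y) z + \<phi> i x (\<phi> (k - i) y z)) = 0)"

definition symmetric_map :: "('a \<Rightarrow> 'a \<Rightarrow> 'a::ab_group_add) \<Rightarrow> 'a \<Rightarrow> 'a \<Rightarrow> 'a"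
  where "symmetric_map \<phi> x y = \<phi> x y + \<phi> y x"

end

theory Submission
  imports Defs
begin

text \<open>
  Write \<open>D\<^sub>k(x,y,z)\<close> for the coefficient of \<open>t^k\<close> in the anti-associator.  Antisymmetrising
  \<open>D\<^sub>1 = 0\<close> under \<open>x \<leftrightarrow> z\<close> leaves, because \<open>\<mu>\<^sub>0\<close> is skew-symmetric, a relation in which \<open>\<phi>\<^sub>1\<close>
  occurs only through \<open>\<rho>\<^sub>1\<close>; a signed sum of its three cyclic shifts is twice the graded
  Leibniz identity.  Summing \<open>D\<^sub>2 = 0\<close> over all six permutations of \<open>x,y,z\<close> cancels every
  term with \<open>\<phi>\<^sub>2\<close>, again by skew-symmetry, and what remains is the Jacobi identity for \<open>\<rho>\<^sub>1\<close>.
\<close>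

lemma bilinear_product_add:
  assumes "bilinear_product scale \<mu>"
  shows "\<mu> (x + y) z = \<mu> x z + \<mu> y z" and "\<mu> x (y + z) = \<mu> x y + \<mu> x z"
  using assms unfolding bilinear_product_def
  by (simp_all add: Vector_Spaces.linear_iff)

lemma bilinear_product_minus:
  assumes "bilinear_product scale \<mu>"
  shows "\<mu> (- x) z = - \<mu> x z" and "\<mu> z (- x) = - \<mu> z x"
proof -
  interpret additive "\<lambda>x. \<mu> x z" by standard (rule bilinear_product_add[OF assms])
  show "\<mu> (- x) z = - \<mu> x z" by (rule minus)
next
  interpret additive "\<mu> z" by standard (rule bilinear_product_add[OF assms])
  show "\<mu> z (- x) = - \<mu> z x" by (rule minus)
qed

lemma bilinear_product_symmetric_map:
  assumes "bilinear_product scale \<phi>"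
  shows "bilinear_product scale (symmetric_map \<phi>)"
  using assms unfolding bilinear_product_def symmetric_map_def
  by (simp add: Vector_Spaces.linear_iff vector_space.vector_space_assms(1) algebra_simps)

text \<open>Characteristic 0 enters here: 2 is a nonzero scalar, so the doubled Leibniz identity can
  be halved.\<close>

lemma (in nonassoc_algebra) double_eq_zeroD:
  fixes x :: 'a
  assumes "x + x = 0"
  shows "x = 0"
proof -
  have "scale 2 x = 0" using assms scale_left_distrib[of 1 1 x] by simp
  then show ?thesis by simp
qed

theorem theorem24:
  fixes scale :: "'k::field_char_0 \<Rightarrow> 'a::ab_group_add \<Rightarrow> 'a"
    and \<mu>\<^sub>0 :: "'a \<Rightarrow> 'a \<Rightarrow> 'a"
    and \<phi> :: "nat \<Rightarrow> 'a \<Rightarrow> 'a \<Rightarrow> 'a"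
  assumes "skew_anti_associative_algebra scale \<mu>\<^sub>0"
    and "anti_associative_deformation scale \<mu>\<^sub>0 \<phi>"
  shows "anti_poisson_algebra scale \<mu>\<^sub>0 (symmetric_map (\<phi> 1))"
proof -
  interpret skew_anti_associative_algebra scale \<mu>\<^sub>0 by fact
  let ?\<rho> = "symmetric_map (\<phi> 1)"
  have bil: "bilinear_product scale (\<phi> k)" for k
    using assms(2) by (simp add: anti_associative_deformation_def)
  note expand = bilinear_product_add[OF bilinear] bilinear_product_minus[OF bilinear]
    bilinear_product_add[OF bil] bilinear_product_minus[OF bil]
  have coeff: "(\<Sum>i\<le>k. \<phi> i (\<phi> (k - i) x y) z + \<phi> i x (\<phi> (k - i) y z)) = 0"
    and zero: "\<phi> 0 = \<mu>\<^sub>0" for k x y z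
    using assms(2) by (auto simp: anti_associative_deformation_def)
  have order1: "\<mu>\<^sub>0 (\<phi> 1 x y) z + \<mu>\<^sub>0 x (\<phi> 1 y z) + \<phi> 1 (\<mu>\<^sub>0 x y) z + \<phi> 1 x (\<mu>\<^sub>0 y z) = 0"
    (is "?D1 x y z = 0") for x y z
    using coeff[where k = 1] by (simp add: zero add.assoc)
  have order2: "\<mu>\<^sub>0 (\<phi> 2 x y) z + \<mu>\<^sub>0 x (\<phi> 2 y z) + \<phi> 1 (\<phi> 1 x y) z + \<phi> 1 x (\<phi> 1 y z)
      + \<phi> 2 (\<mu>\<^sub>0 x y) z + \<phi> 2 x (\<mu>\<^sub>0 y z) = 0"
    (is "?D2 x y z = 0") for x y z
    using coeff[where k = 2] by (simp add: zero numeral_2_eq_2 add.assoc)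
  have jac: "?\<rho> x (?\<rho> y z) + ?\<rho> y (?\<rho> z x) + ?\<rho> z (?\<rho> x y) = 0" for x y z
  proof -
    have "?\<rho> x (?\<rho> y z) + ?\<rho> y (?\<rho> z x) + ?\<rho> z (?\<rho> x y)
      = ?D2 x y z + ?D2 y z x + ?D2 z x y + ?D2 z y x + ?D2 y x z + ?D2 x z y"
      \<comment> \<open>Unrestricted \<open>skew\<close> would loop; these instances move
        \<open>\<phi> 2\<close> values to the right factor and orient products of variables
        cyclically, so opposite terms cancel.\<close>
      unfolding symmetric_map_def skew[of "\<phi> 2 _ _"] skew[of y x] skew[of z y] skew[of x z] expand
      by (simp add: algebra_simps)
    then show ?thesis by (simp only: order2 add_0)
  qed
  have leib: "?\<rho> (\<mu>\<^sub>0 x y) z + \<mu>\<^sub>0 x (?\<rho> y z) + \<mu>\<^sub>0 (?\<rho> x z) y = 0" (is "?L = 0") for x y z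
  proof -
    \<comment> \<open>The middle minus sign cancels \<open>?\<rho>\<close> of (yz, x) and of (zx,
      y), and z times \<open>?\<rho> x y\<close>; the other terms occur twice.\<close>
    have "?L + ?L = (?D1 x y z - ?D1 z y x) - (?D1 y z x - ?D1 x z y) + (?D1 z x y - ?D1 y x z)"
      unfolding symmetric_map_def expand skew[of "\<phi> 1 _ _"] skew[of y x] skew[of z y] skew[of x z]
      by (simp add: algebra_simps expand)
    then have "?L + ?L = 0" by (simp only: order1 diff_self add_0)
    then show ?thesis by (rule double_eq_zeroD)
  qed
  show ?thesis
    by unfold_locales
      (use bilinear_product_symmetric_map[OF bil] jac leib in \<open>auto simp: symmetric_map_def add.commute\<close>)
qed

end
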